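(* Let $K$ be a finite simplicial complex, let $d\ge 0$, let $n=\#S_d(K)\ge 1$, and let $\Delta_1$ be either the signless up 1-Laplacian $\Delta_{1,d}^{up}$ or the signless down 1-Laplacian $\Delta_{1,d}^{down}$ on the $d$-faces of $K$. Let $c_1\le c_2\le\cdots\le c_n$ be the corresponding variational (genus min-max) eigenvalues. Let $c_k$ be an eigenvalue of multiplicity $r$, i.e. $c_{k-1}<c_k=\cdots=c_{k+r-1}<c_{k+r}$ (the first, resp. last, strict inequality being omitted if $k=1$, resp. $k+r-1=n$), and let $f^k$ be an eigenvector of $\Delta_1$ associated with $c_k$. Then $$1\le S(f^k)\le k+r-1,$$ where $S(f^k)$ is the number of (up-, resp. down-) nodal domains of $f^k$.
   Context: An abstract simplicial complex $K$ on a finite vertex set $V$ is a family of subsets of $V$ (faces) closed under taking subsets. A $d$-face is a face of cardinality $d+1$; $S_d(K)$ is the set of $d$-faces (so $S_{-1}(K)=\{\emptyset\}$). Enumerate $S_d(K)=\{F_1,\dots,F_n\}$ and write $f_i=f(F_i)$ for $f\in\mathbb R^n$. For $t\in\mathbb R$: $\mathrm{Sgn}(t)=\{1\}$ if $t>0$, $\{-1\}$ if $t<0$, $[-1,1]$ if $t=0$; for vectors, $\mathrm{Sgn}(f)=\prod_i \mathrm{Sgn}(f_i)$. Let $B^{up}$ be the $0/1$ matrix with rows indexed by $S_{d+1}(K)$, columns by $S_d(K)$, and entry $1$ iff the $d$-face is contained in the $(d+1)$-face. Let $B^{down}$ be the $0/1$ matrix with rows indexed by $S_{d-1}(K)$,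 columns by $S_d(K)$, and entry $1$ iff the $(d-1)$-face is contained in the $d$-face. In the up case put $B=B^{up}$ and let $\deg_i$ be the number of $(d+1)$-faces containing $F_i$; in the down case put $B=B^{down}$ and $\deg_i=d+1$. It is assumed that $\deg_i>0$ for all $i$. The signless 1-Laplacian is $\Delta_1 f=\{B^{\top}g: g\in\mathrm{Sgn}(Bf)\}$. A pair $(\mu,f)\in\mathbb R\times(\mathbb R^n\setminus\{0\})$ is an eigenpair (with $\mu$ an eigenvalue and $f$ an eigenvector) if $\Delta_1 f\cap \mu D\,\mathrm{Sgn}(f)\ne\varnothing$, where $D=\mathrm{diag}(\deg_1,\dots,\deg_n)$. Put $I(f)=\|Bf\|_{\ell^1}$ (the sum of absolute values of the entries of $Bf$), $\|f\|=\sum_i \deg_i|f_i|$ and $X=\{f\in\mathbb R^n:\|f\|=1\}$. For symmetric $T=-T\subset X$, the Krasnoselski genus is $\gamma(\varnothing)=0$ and otherwise $\gamma(T)=\min\{k: \text{there is an odd continuous map } T\to\mathbb S^{k-1}\}$. The variational eigenvalues are $c_k=\inf_{T\subset X,\ T=-T,\ \gamma(T)\ge k}\ \max_{f\in T} I(f)$, $k=1,\dots,n$ (with $\max$ read as $\sup$). Two distinct $d$-faces are up-neighbours if they are contained in a common $(d+1)$-face, and down-neighbours if they share a common $(d-1)$-face. A set of $d$-faces is up- (down-) connected if any two of its elements are joined by a chain, inside the set, of successive up- (down-) neighbours. The nodal domains of $f$ are the maximal up-connected (for the up 1-Laplacian), resp. down-connected (for the down 1-Laplacian), subsets of the support $\{i:f_i\neq0\}$.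 *)

theory Defs
  imports "HOL-Analysis.Analysis" "HOL-Library.Extended_Nat"
begin

definition abstract_simplicial_complex :: "'a set \<Rightarrow> 'a set set \<Rightarrow> bool" where
  "abstract_simplicial_complex V K \<longleftrightarrow>
     finite V \<and> K \<subseteq> Pow V \<and> (\<forall>F\<in>K. \<forall>G. G \<subseteq> F \<longrightarrow> G \<in> K)"

(* The dimension is an integer so that faces K (-1) is {{}} for every nonempty complex K. *)
definition faces :: "'a set set \<Rightarrow> int \<Rightarrow> 'a set set" where
  "faces K j = {F \<in> K. int (card F) = j + 1}"

(* Vectors indexed by a finite set A are the functions vanishing outside A; with the topology
   of pointwise convergence on functions, vectors A is a copy of Euclidean space of dimension
   card A. *)
definition vectors :: "'i set \<Rightarrow> ('i \<Rightarrow> real) set" where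
  "vectors A = {f. \<forall>i. i \<notin> A \<longrightarrow> f i = 0}"

definition Sgn_real :: "real \<Rightarrow> real set" where
  "Sgn_real t = (if t > 0 then {1} else if t < 0 then {-1} else {-1..1})"

definition Sgn :: "'i set \<Rightarrow> ('i \<Rightarrow> real) \<Rightarrow> ('i \<Rightarrow> real) set" where
  "Sgn A f = {g \<in> vectors A. \<forall>i\<in>A. g i \<in> Sgn_real (f i)}"

datatype direction = Up | Down

fun row_faces :: "direction \<Rightarrow> 'a set set \<Rightarrow> nat \<Rightarrow> 'a set set" where
  "row_faces Up K d = faces K (int d + 1)"
| "row_faces Down K d = faces K (int d - 1)"

fun incidence :: "direction \<Rightarrow> 'a set \<Rightarrow> 'a set \<Rightarrow> real" where
  "incidence Up G F = of_bool (F \<subseteq> G)"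
| "incidence Down G F = of_bool (G \<subseteq> F)"

definition mult_B :: "direction \<Rightarrow> 'a set set \<Rightarrow> nat \<Rightarrow> ('a set \<Rightarrow> real) \<Rightarrow> 'a set \<Rightarrow> real" where
  "mult_B dir K d f = (\<lambda>G. if G \<in> row_faces dir K d
     then \<Sum>F\<in>faces K (int d). incidence dir G F * f F else 0)"

definition mult_B_transpose :: "direction \<Rightarrow> 'a set set \<Rightarrow> nat \<Rightarrow> ('a set \<Rightarrow> real) \<Rightarrow> 'a set \<Rightarrow> real" where
  "mult_B_transpose dir K d g = (\<lambda>F. if F \<in> faces K (int d)
     then \<Sum>G\<in>row_faces dir K d. incidence dir G F * g G else 0)"

fun face_degree :: "direction \<Rightarrow> 'a set set \<Rightarrow> nat \<Rightarrow> 'a set \<Rightarrow> nat" where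
  "face_degree Up K d F = card {G \<in> faces K (int d + 1). F \<subseteq> G}"
| "face_degree Down K d F = d + 1"

definition signless_1_laplacian ::
    "direction \<Rightarrow> 'a set set \<Rightarrow> nat \<Rightarrow> ('a set \<Rightarrow> real) \<Rightarrow> ('a set \<Rightarrow> real) set" where
  "signless_1_laplacian dir K d f =
     mult_B_transpose dir K d ` Sgn (row_faces dir K d) (mult_B dir K d f)"

definition eigenpair :: "direction \<Rightarrow> 'a set set \<Rightarrow> nat \<Rightarrow> real \<Rightarrow> ('a set \<Rightarrow> real) \<Rightarrow> bool" where
  "eigenpair dir K d \<mu> f \<longleftrightarrow>
     f \<in> vectors (faces K (int d)) \<and> f \<noteq> (\<lambda>_. 0) \<and>
     signless_1_laplacian dir K d f \<inter>
       (\<lambda>s F. \<mu> * (real (face_degree dir K d F) * s F)) ` Sgn (faces K (int d)) f \<noteq> {}"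

definition energy :: "direction \<Rightarrow> 'a set set \<Rightarrow> nat \<Rightarrow> ('a set \<Rightarrow> real) \<Rightarrow> real" where
  "energy dir K d f = (\<Sum>G\<in>row_faces dir K d. \<bar>mult_B dir K d f G\<bar>)"

definition weighted_norm :: "direction \<Rightarrow> 'a set set \<Rightarrow> nat \<Rightarrow> ('a set \<Rightarrow> real) \<Rightarrow> real" where
  "weighted_norm dir K d f = (\<Sum>F\<in>faces K (int d). real (face_degree dir K d F) * \<bar>f F\<bar>)"

definition unit_vectors :: "direction \<Rightarrow> 'a set set \<Rightarrow> nat \<Rightarrow> ('a set \<Rightarrow> real) set" where
  "unit_vectors dir K d = {f \<in> vectors (faces K (int d)). weighted_norm dir K d f = 1}"

(* nsphere (k - 1) is the unit sphere of a k-dimensional space.  The infimum in enat is a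
   minimum unless no suitable k exists, in which case it is infinity. *)
definition krasnoselski_genus :: "('i \<Rightarrow> real) set \<Rightarrow> enat" where
  "krasnoselski_genus T = (if T = {} then 0 else
     Inf {enat k | k. k \<ge> 1 \<and>
       (\<exists>h. continuous_map (top_of_set T) (nsphere (k - 1)) h \<and> (\<forall>f\<in>T. h (- f) = - h f))})"

(* Both bounds are taken over bounded nonempty sets of reals when 1 \<le> k \<le> card (faces K d)
   and all degrees are positive. *)
definition variational_eigenvalue :: "direction \<Rightarrow> 'a set set \<Rightarrow> nat \<Rightarrow> nat \<Rightarrow> real" where
  "variational_eigenvalue dir K d k =
     (INF T \<in> {T. T \<subseteq> unit_vectors dir K d \<and> uminus ` T = T \<and> enat k \<le> krasnoselski_genus T}.
        SUP f\<in>T. energy dir K d f)"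

fun neighbours :: "direction \<Rightarrow> 'a set set \<Rightarrow> nat \<Rightarrow> 'a set \<Rightarrow> 'a set \<Rightarrow> bool" where
  "neighbours Up K d F F' \<longleftrightarrow>
     F \<noteq> F' \<and> (\<exists>G\<in>faces K (int d + 1). F \<subseteq> G \<and> F' \<subseteq> G)"
| "neighbours Down K d F F' \<longleftrightarrow>
     F \<noteq> F' \<and> (\<exists>G\<in>faces K (int d - 1). G \<subseteq> F \<and> G \<subseteq> F')"

definition face_connected :: "direction \<Rightarrow> 'a set set \<Rightarrow> nat \<Rightarrow> 'a set set \<Rightarrow> bool" where
  "face_connected dir K d A \<longleftrightarrow>
     (\<forall>F\<in>A. \<forall>F'\<in>A. (F, F') \<in> {(x, y). x \<in> A \<and> y \<in> A \<and> neighbours dir K d x y}\<^sup>*)"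

definition face_support :: "'a set set \<Rightarrow> nat \<Rightarrow> ('a set \<Rightarrow> real) \<Rightarrow> 'a set set" where
  "face_support K d f = {F \<in> faces K (int d). f F \<noteq> 0}"

definition nodal_domains :: "direction \<Rightarrow> 'a set set \<Rightarrow> nat \<Rightarrow> ('a set \<Rightarrow> real) \<Rightarrow> 'a set set set" where
  "nodal_domains dir K d f = {A. A \<subseteq> face_support K d f \<and> face_connected dir K d A \<and>
     (\<forall>A'. A \<subseteq> A' \<and> A' \<subseteq> face_support K d f \<and> face_connected dir K d A' \<longrightarrow> A' = A)}"

end

theory Submission
  imports Defs "HOL-Homology.Invariance_of_Domain"
begin

text \<open>Rescaling an eigenvector separately on each of its nodal domains does not change the ratio of
energy to norm. Let \<open>f\<close> be an eigenvector for \<open>\<mu>\<close> and let \<open>h\<close> be constant on each nodal domain. All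
support faces incident to one row face \<open>G\<close> are pairwise neighbours, so \<open>h\<close> has a single value there
and \<open>B (h f)\<close> is at \<open>G\<close> a multiple of \<open>B f\<close>. Pairing with the sign vector \<open>g\<close> of the eigenvalue
equation gives \<open>I (h f) = \<langle>g, B (\<bar>h\<bar> f)\<rangle> = \<langle>B\<^sup>T g, \<bar>h\<bar> f\<rangle> = \<mu> \<parallel>h f\<parallel>\<close>
(\<open>energy_locally_constant_multiple\<close>). If there are \<open>m\<close> nodal domains, the normalised vectors \<open>h f\<close>
thus form an odd continuous image of the sphere of dimension \<open>m - 1\<close> on which \<open>I\<close> has the constant value
\<open>\<mu>\<close>. The genus of such an image is at least \<open>m\<close>, so \<open>c\<^sub>j \<le> \<mu>\<close> for all \<open>j \<le> m\<close>
(\<open>variational_eigenvalue_le_eigenvalue\<close>). With \<open>\<mu> = c\<^sub>k < c\<^bsub>k+r\<^esub>\<close> this excludes \<open>m \<ge> k + r\<close>.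

The lower bound on the genus is the Borsuk-Ulam theorem in the form that no odd continuous map
goes from a sphere to a sphere of smaller dimension. It follows from the fact that an odd self-map of a
sphere has odd degree: a map into a proper subsphere is not surjective and has degree \<open>0\<close>. The
degree theorem is proved by induction on the dimension. Degrees of an odd map and of its restriction to
the equator have the same parity as soon as the map preserves the equator
(\<open>Borsuk_odd_mapping_degree_step\<close>), so an arbitrary odd map \<open>f\<close> has to be deformed, through
nonvanishing maps and with odd end result, into one that preserves the equator. Approximate \<open>f\<close> by an odd
Lipschitz map \<open>F\<close>. Counting small boxes shows that the Lipschitz image of the equator is too
small to meet all lines in the target, so it misses one line, transverse to the equatorial hyperplane
(\<open>lipschitz_image_misses_line\<close>). Shearing that line onto the last axis and shrinking the last coordinate
of \<open>F\<close> by the factor \<open>\<bar>x\<^sub>n\<bar>\<close>, which vanishes exactly on the equator, is the required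
deformation.\<close>

section \<open>Unit spheres as sets of real sequences\<close>

definition usphere :: "nat \<Rightarrow> (nat \<Rightarrow> real) set" where
  "usphere n = {x. (\<Sum>i\<le>n. (x i)\<^sup>2) = 1 \<and> (\<forall>i>n. x i = 0)}"

lemma nsphere_eq_usphere: "nsphere n = top_of_set (usphere n)"
  by (simp add: nsphere usphere_def euclidean_product_topology)

lemma usphere_uminus: "x \<in> usphere n \<Longrightarrow> - x \<in> usphere n"
  by (simp add: usphere_def)

lemma usphere_equator: "x \<in> usphere m \<longleftrightarrow> x \<in> usphere (Suc m) \<and> x (Suc m) = 0"
proof -
  have "(\<forall>i>m. x i = 0) \<longleftrightarrow> (\<forall>i>Suc m. x i = 0) \<and> x (Suc m) = 0"
    by (metis Suc_lessD Suc_lessI lessI)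
  then show ?thesis by (auto simp: usphere_def)
qed

lemma usphere_mono: "m \<le> n \<Longrightarrow> usphere m \<subseteq> usphere n"
  by (induction n rule: dec_induct) (use usphere_equator in blast)+

lemma usphere_coordinate_bound:
  assumes "x \<in> usphere n"
  shows "\<bar>x i\<bar> \<le> 1"
proof (cases "i \<le> n")
  case True
  have "(x i)\<^sup>2 \<le> (\<Sum>i\<le>n. (x i)\<^sup>2)"
    using True by (intro member_le_sum) auto
  then show ?thesis
    using assms by (simp add: usphere_def abs_square_le_1)
qed (use assms in \<open>auto simp: usphere_def\<close>)

lemma usphere_large_coordinate:
  assumes x: "x \<in> usphere m"
  shows "\<exists>j\<le>m. 1 / real (Suc m) \<le> \<bar>x j\<bar>"
proof (rule ccontr)
  assume no: "\<not> ?thesis"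
  have "(\<Sum>j\<le>m. (x j)\<^sup>2) < (\<Sum>j\<le>m. 1 / real (Suc m))"
  proof (rule sum_strict_mono)
    fix j assume "j \<in> {..m}"
    then have "\<bar>x j\<bar> < 1 / real (Suc m)" using no by force
    moreover have "\<bar>x j\<bar> \<le> 1" using x usphere_coordinate_bound by blast
    ultimately show "(x j)\<^sup>2 < 1 / real (Suc m)"
      using mult_left_le[of "\<bar>x j\<bar>" "\<bar>x j\<bar>"] by (simp add: power2_eq_square flip: abs_mult)
  qed auto
  then show False using x by (auto simp: usphere_def)
qed

lemma compact_usphere: "compact (usphere n)"
proof -
  have "compactin (powertop_real UNIV) (PiE UNIV (\<lambda>_. {-1..1::real}))"
    by (simp add: compactin_PiE)
  then have "compact (PiE UNIV (\<lambda>_. {-1..1}) :: (nat \<Rightarrow> real) set)"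
    by (simp add: euclidean_product_topology)
  moreover have "closed (usphere n)"
    unfolding usphere_def
    by (intro closed_Collect_conj closed_Collect_all closed_Collect_imp closed_Collect_eq
        continuous_intros continuous_on_product_coordinates) auto
  moreover have "usphere n \<subseteq> PiE UNIV (\<lambda>_. {-1..1})"
    using usphere_coordinate_bound by (force simp: abs_le_iff)
  ultimately show ?thesis
    by (metis compact_Int_closed inf.absorb2)
qed

lemma continuous_on_coordinate:
  "continuous_on S g \<Longrightarrow> continuous_on S (\<lambda>x. g x i)"
  for g :: "'a::topological_space \<Rightarrow> 'i \<Rightarrow> real"
  by (rule continuous_on_product_then_coordinatewise)

section \<open>Degree and nonvanishing homotopies\<close>

definition normalise :: "nat \<Rightarrow> (nat \<Rightarrow> real) \<Rightarrow> nat \<Rightarrow> real" where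
  "normalise n v = (\<lambda>i. if i \<le> n then v i / sqrt (\<Sum>j\<le>n. (v j)\<^sup>2) else 0)"

lemma sum_squares_pos:
  fixes v :: "nat \<Rightarrow> real"
  assumes "i \<le> n" "v i \<noteq> 0"
  shows "0 < (\<Sum>j\<le>n. (v j)\<^sup>2)"
  using assms by (intro sum_pos2[of _ i]) auto

lemma normalise_in_usphere:
  assumes "i \<le> n" "v i \<noteq> 0"
  shows "normalise n v \<in> usphere n"
  using sum_squares_pos[of i n v] assms
  by (simp add: usphere_def normalise_def power_divide flip: sum_divide_distrib)

lemma normalise_usphere: "x \<in> usphere n \<Longrightarrow> normalise n x = x"
  by (auto simp: usphere_def normalise_def)

lemma normalise_uminus: "normalise n (- v) = - normalise n v"
  by (auto simp: normalise_def)

lemma continuous_on_normalise: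
  fixes H :: "'a::topological_space \<Rightarrow> nat \<Rightarrow> real"
  assumes "\<And>i. i \<le> n \<Longrightarrow> continuous_on S (\<lambda>p. H p i)"
    and "\<And>p. p \<in> S \<Longrightarrow> \<exists>i\<le>n. H p i \<noteq> 0"
  shows "continuous_on S (\<lambda>p. normalise n (H p))"
proof (rule continuous_on_coordinatewise_then_product)
  fix i
  have "sqrt (\<Sum>j\<le>n. (H p j)\<^sup>2) \<noteq> 0" if "p \<in> S" for p
    using assms(2)[OF that] sum_squares_pos by (metis less_numeral_extra(3) real_sqrt_eq_zero_cancel_iff)
  then show "continuous_on S (\<lambda>p. normalise n (H p) i)"
    unfolding normalise_def using assms(1) by (cases "i \<le> n") (auto intro!: continuous_intros)
qed

text \<open>Homotopies can be given by formulas that merely avoid the origin; radial projection turns them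
into homotopies of self-maps of the sphere.\<close>

lemma degree_homotopy_nonvanishing:
  fixes H :: "real \<times> (nat \<Rightarrow> real) \<Rightarrow> nat \<Rightarrow> real"
  assumes "\<And>i. i \<le> n \<Longrightarrow> continuous_on ({0..1} \<times> usphere n) (\<lambda>p. H p i)"
    and "\<And>s x. s \<in> {0..1} \<Longrightarrow> x \<in> usphere n \<Longrightarrow> \<exists>i\<le>n. H (s, x) i \<noteq> 0"
  shows "Brouwer_degree2 n (\<lambda>x. normalise n (H (0, x))) = Brouwer_degree2 n (\<lambda>x. normalise n (H (1, x)))"
proof (rule Brouwer_degree2_homotopic)
  have "continuous_on ({0..1} \<times> usphere n) (\<lambda>p. normalise n (H p))"
    using assms by (intro continuous_on_normalise) auto
  moreover have "(\<lambda>p. normalise n (H p)) \<in> {0..1} \<times> usphere n \<rightarrow> usphere n"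
    using assms(2) normalise_in_usphere by (auto simp: Pi_iff) blast
  ultimately show "homotopic_with (\<lambda>x. True) (nsphere n) (nsphere n)
      (\<lambda>x. normalise n (H (0, x))) (\<lambda>x. normalise n (H (1, x)))"
    unfolding nsphere_eq_usphere homotopic_with_def
    by (intro exI[of _ "\<lambda>p. normalise n (H p)"]) auto
qed

section \<open>Lipschitz approximation\<close>

text \<open>The infimum over \<open>y\<close> of \<open>f y + L * dist x y\<close>, as a function of \<open>x\<close>, is \<open>L\<close>-Lipschitz and lies below \<open>f\<close>. It is close to \<open>f\<close>
once \<open>L\<close> is so large that points outside the modulus of uniform continuity cannot lower the infimum.\<close>

lemma lipschitz_approximation:
  fixes f :: "'a::metric_space \<Rightarrow> real"
  assumes "compact S" "continuous_on S f" "0 < e"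
  shows "\<exists>g L. L-lipschitz_on S g \<and> (\<forall>x\<in>S. \<bar>g x - f x\<bar> \<le> e)"
proof (cases "S = {}")
  case False
  obtain b where b: "\<And>x. x \<in> S \<Longrightarrow> \<bar>f x\<bar> \<le> b"
    using compact_imp_bounded[OF compact_continuous_image[OF assms(2,1)]]
    by (auto simp: bounded_real)
  have "b \<ge> 0" using b False by force
  obtain d where d: "d > 0" "\<And>x y. x \<in> S \<Longrightarrow> y \<in> S \<Longrightarrow> dist y x < d \<Longrightarrow> \<bar>f y - f x\<bar> < e"
    using compact_uniformly_continuous[OF assms(2,1)] \<open>0 < e\<close>
    unfolding uniformly_continuous_on_def dist_real_def by metis
  \<comment> \<open>\<open>L * d\<close> equals the largest possible oscillation \<open>2 * b\<close> of \<open>f\<close>.\<close>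
  define L where "L = 2 * b / d"
  have "L \<ge> 0" using \<open>b \<ge> 0\<close> \<open>d > 0\<close> by (simp add: L_def)
  define g where "g x = (INF y\<in>S. f y + L * dist x y)" for x
  have lower: "- b \<le> f y + L * dist x y" if "y \<in> S" for x y
    using b[OF that] \<open>L \<ge> 0\<close> by (smt (verit) mult_nonneg_nonneg zero_le_dist)
  have bdd: "bdd_below ((\<lambda>y. f y + L * dist x y) ` S)" for x
    using lower by (auto intro!: bdd_belowI2)
  have le: "g x \<le> g y + L * dist x y" if "x \<in> S" "y \<in> S" for x y
  proof -
    have "g x - L * dist x y \<le> f z + L * dist y z" if z: "z \<in> S" for z
    proof -
      have "g x \<le> f z + L * dist x z"
        unfolding g_def by (rule cINF_lower[OF bdd z])
      also have "\<dots> \<le> f z + L * (dist x y + dist y z)"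
        using \<open>L \<ge> 0\<close> by (simp add: mult_left_mono dist_triangle)
      finally show ?thesis by (simp add: algebra_simps)
    qed
    then have "g x - L * dist x y \<le> g y"
      unfolding g_def[of y] by (rule cINF_greatest[OF False])
    then show ?thesis by simp
  qed
  have "L-lipschitz_on S g"
  proof (rule lipschitz_onI)
    fix x y assume "x \<in> S" "y \<in> S"
    then show "dist (g x) (g y) \<le> L * dist x y"
      using le[of x y] le[of y x] by (simp add: dist_real_def dist_commute)
  qed (fact \<open>L \<ge> 0\<close>)
  moreover have "\<bar>g x - f x\<bar> \<le> e" if x: "x \<in> S" for x
  proof -
    have "g x \<le> f x"
      using cINF_lower[OF bdd x, of x] by (simp add: g_def)
    moreover have "f x - e \<le> f y + L * dist x y" if y: "y \<in> S" for y
    proof (cases "dist x y < d")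
      case True
      then show ?thesis
        using d(2)[OF y x] \<open>L \<ge> 0\<close> by (smt (verit) mult_nonneg_nonneg zero_le_dist)
    next
      case False
      then have "L * dist x y \<ge> L * d"
        using \<open>L \<ge> 0\<close> by (intro mult_left_mono) auto
      then show ?thesis
        using b[OF x] b[OF y] d(1) \<open>0 < e\<close> by (simp add: L_def)
    qed
    then have "f x - e \<le> g x"
      unfolding g_def by (rule cINF_greatest[OF False])
    ultimately show ?thesis by simp
  qed
  ultimately show ?thesis by blast
qed (use lipschitz_on_empty_iff in auto)

lemma dist_fun_uminus: "dist (- x) (- y) = dist x (y :: nat \<Rightarrow> real)"
  by (simp add: dist_fun_def dist_minus)

lemma dist_fun_le_coordinate_bound:
  fixes x y :: "nat \<Rightarrow> real"
  assumes "\<And>i. \<bar>x i - y i\<bar> \<le> M"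
  shows "dist x y \<le> 2 * M"
proof -
  have "M \<ge> 0" using assms[of 0] by linarith
  have sums: "(\<lambda>i. (1/2)^i * M) sums (2 * M)"
    using sums_mult2[OF geometric_sums[of "1/2::real"], of M] by simp
  have le: "(1/2)^i * min (dist (x (from_nat i)) (y (from_nat i))) 1 \<le> (1/2)^i * M" for i
    using assms by (intro mult_left_mono) (auto simp: dist_real_def min.coboundedI1)
  have "summable (\<lambda>i. (1/2)^i * min (dist (x (from_nat i)) (y (from_nat i))) 1)"
    by (rule summable_comparison_test'[OF sums_summable[OF sums], of 0]) (use le in auto)
  then have "dist x y \<le> suminf (\<lambda>i. (1/2)^i * M)"
    unfolding dist_fun_def using le sums_summable[OF sums] by (intro suminf_le) auto
  then show ?thesis using sums_unique[OF sums] by simp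
qed

text \<open>Antisymmetrising a Lipschitz approximation keeps the Lipschitz constant, because \<open>x \<mapsto> - x\<close> is an
isometry, and keeps the error, because \<open>f\<close> is its own antisymmetrisation.\<close>

lemma odd_lipschitz_approximation:
  fixes f :: "(nat \<Rightarrow> real) \<Rightarrow> real"
  assumes "continuous_on (usphere n) f" "\<And>x. x \<in> usphere n \<Longrightarrow> f (- x) = - f x" "0 < e"
  shows "\<exists>g L. L-lipschitz_on (usphere n) g \<and> (\<forall>x\<in>usphere n. g (- x) = - g x) \<and>
           (\<forall>x\<in>usphere n. \<bar>g x - f x\<bar> \<le> e)"
proof -
  obtain g L where L: "L-lipschitz_on (usphere n) g" and g: "\<And>x. x \<in> usphere n \<Longrightarrow> \<bar>g x - f x\<bar> \<le> e"
    using lipschitz_approximation[OF compact_usphere assms(1,3)] by blast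
  define g' where "g' x = (g x - g (- x)) / 2" for x
  have "L-lipschitz_on (usphere n) g'"
  proof (rule lipschitz_onI)
    fix x y assume xy: "x \<in> usphere n" "y \<in> usphere n"
    have "dist (g x) (g y) \<le> L * dist x y" "dist (g (-x)) (g (-y)) \<le> L * dist x y"
      using lipschitz_onD[OF L xy] lipschitz_onD[OF L usphere_uminus[OF xy(1)] usphere_uminus[OF xy(2)]]
      by (simp_all add: dist_fun_uminus)
    then show "dist (g' x) (g' y) \<le> L * dist x y"
      by (simp add: g'_def dist_real_def abs_le_iff field_simps)
  qed (rule lipschitz_on_nonneg[OF L])
  moreover have "- (- x) = x" for x :: "nat \<Rightarrow> real"
    by (simp add: fun_eq_iff)
  then have "g' (- x) = - g' x" for x
    by (simp add: g'_def field_simps)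
  moreover have "\<bar>g' x - f x\<bar> \<le> e" if "x \<in> usphere n" for x
    using g[OF that] g[OF usphere_uminus[OF that]] assms(2)[OF that]
    by (simp add: g'_def abs_le_iff field_simps)
  ultimately show ?thesis by blast
qed

section \<open>General position by counting\<close>

text \<open>A sphere of dimension \<open>m\<close> holds only \<open>O(B\<^sup>m)\<close> points at mutual distance of order \<open>1 / B\<close>. The exponent is \<open>m\<close> and
not \<open>m + 1\<close> because a point is determined, up to an error of order \<open>1 / B\<close>, by the position and sign
of a coordinate of absolute value at least \<open>1 / (m + 1)\<close> together with the boxes of side \<open>1 / B\<close> that contain the
other \<open>m\<close> coordinates: the equation of the sphere recovers the large coordinate.\<close>

lemma usphere_packing:
  assumes "finite P" "P \<subseteq> usphere m" "B \<ge> (1::nat)"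
    and "card P > Suc m * (2 * (2 * B + 1) ^ m)"
  shows "\<exists>x\<in>P. \<exists>y\<in>P. x \<noteq> y \<and> dist x y \<le> 2 * (real (Suc m))\<^sup>2 / real B"
proof -
  define n where "n = real (Suc m)"
  have n: "n \<ge> 1" by (simp add: n_def)
  have "\<forall>x\<in>P. \<exists>j\<le>m. 1 / n \<le> \<bar>x j\<bar>"
    using usphere_large_coordinate assms(2) unfolding n_def by blast
  then obtain j where j: "\<And>x. x \<in> P \<Longrightarrow> j x \<le> m \<and> 1 / n \<le> \<bar>x (j x)\<bar>"
    by metis
  \<comment> \<open>The data that determine a point approximately; two points of \<open>P\<close> must share them.\<close>
  define key where "key x = (j x, x (j x) > 0, restrict (\<lambda>i. \<lfloor>real B * x i\<rfloor>) ({..m} - {j x}))" for x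
  define Keys where "Keys = Sigma {..m} (\<lambda>j. (UNIV::bool set) \<times> PiE ({..m} - {j}) (\<lambda>_. {- int B..int B}))"
  have "finite Keys" unfolding Keys_def by (intro finite_SigmaI finite_PiE) auto
  have "card Keys = (\<Sum>j\<le>m. card ((UNIV::bool set) \<times> PiE ({..m} - {j}) (\<lambda>_. {- int B..int B})))"
    unfolding Keys_def by (rule card_SigmaI) (auto intro!: finite_PiE)
  also have "\<dots> = (\<Sum>j\<le>m. 2 * (2 * B + 1) ^ m)"
  proof (rule sum.cong[OF refl])
    fix j assume "j \<in> {..m}"
    moreover have "nat (int B - - int B + 1) = 2 * B + 1" by simp
    ultimately show "card ((UNIV::bool set) \<times> PiE ({..m} - {j}) (\<lambda>_. {- int B..int B})) = 2 * (2 * B + 1) ^ m"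
      by (simp only: card_cartesian_product card_UNIV_bool card_PiE finite_Diff finite_atMost
          prod_constant card_atLeastAtMost_int) simp
  qed
  finally have "card Keys = (\<Sum>j\<le>m. 2 * (2 * B + 1) ^ m)" .
  then have "card Keys < card P" using assms(4) by simp
  have "key ` P \<subseteq> Keys"
  proof
    fix k assume "k \<in> key ` P"
    then obtain x where x: "x \<in> P" "k = key x" by blast
    have "- int B \<le> \<lfloor>real B * x i\<rfloor> \<and> \<lfloor>real B * x i\<rfloor> \<le> int B" for i
    proof -
      have "\<bar>real B * x i\<bar> \<le> real B"
        using usphere_coordinate_bound[of x m i] x assms(2) by (auto simp: abs_mult mult_left_le)
      then show ?thesis by (simp add: le_floor_iff floor_le_iff abs_le_iff)
    qed
    then show "k \<in> Keys" using j[OF x(1)] by (auto simp: x(2) key_def Keys_def)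
  qed
  then have "\<not> inj_on key P"
    using \<open>card Keys < card P\<close> \<open>finite Keys\<close> by (metis card_image card_mono not_le)
  then obtain x y where xy: "x \<in> P" "y \<in> P" "x \<noteq> y" "key x = key y"
    by (auto simp: inj_on_def)
  have jj: "j y = j x" and sgn: "x (j x) > 0 \<longleftrightarrow> y (j x) > 0"
    and fl: "restrict (\<lambda>i. \<lfloor>real B * x i\<rfloor>) ({..m} - {j x}) = restrict (\<lambda>i. \<lfloor>real B * y i\<rfloor>) ({..m} - {j x})"
    using xy(4) by (auto simp: key_def)
  have near: "\<bar>x i - y i\<bar> \<le> 1 / real B" if "i \<in> {..m} - {j x}" for i
  proof -
    have "\<lfloor>real B * x i\<rfloor> = \<lfloor>real B * y i\<rfloor>"
      using fun_cong[OF fl, of i] that by simp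
    then have "\<bar>real B * x i - real B * y i\<bar> \<le> 1" by linarith
    then have "real B * \<bar>x i - y i\<bar> \<le> 1" by (simp add: abs_mult flip: right_diff_distrib)
    then show ?thesis using assms(3) by (simp add: field_simps)
  qed
  have S: "(\<Sum>i\<le>m. (z i)\<^sup>2) = (z (j x))\<^sup>2 + (\<Sum>i\<in>{..m} - {j x}. (z i)\<^sup>2)" for z :: "nat \<Rightarrow> real"
    using j[OF xy(1)] by (intro sum.remove) auto
  \<comment> \<open>Both large coordinates have the same sign, so \<open>\<bar>a + b\<bar> \<ge> 2 / n\<close> and dividing
      \<open>a\<^sup>2 - b\<^sup>2\<close> by \<open>a + b\<close> costs only the factor \<open>n / 2\<close>.\<close>
  have jnear: "\<bar>x (j x) - y (j x)\<bar> \<le> n\<^sup>2 / real B"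
  proof -
    let ?a = "x (j x)" and ?b = "y (j x)"
    have one: "(\<Sum>i\<le>m. (x i)\<^sup>2) = 1" "(\<Sum>i\<le>m. (y i)\<^sup>2) = 1"
      using xy assms(2) by (auto simp: usphere_def)
    have "(?a - ?b) * (?a + ?b) = ?a\<^sup>2 - ?b\<^sup>2" by (simp add: power2_eq_square algebra_simps)
    also have "\<dots> = (\<Sum>i\<in>{..m} - {j x}. (y i)\<^sup>2 - (x i)\<^sup>2)"
      using S[of x] S[of y] one by (simp add: sum_subtractf)
    also have "\<bar>\<dots>\<bar> \<le> (\<Sum>i\<in>{..m} - {j x}. 2 / real B)"
    proof (rule order_trans[OF sum_abs sum_mono])
      fix i assume i: "i \<in> {..m} - {j x}"
      have "\<bar>(y i)\<^sup>2 - (x i)\<^sup>2\<bar> = \<bar>x i - y i\<bar> * \<bar>x i + y i\<bar>"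
        by (simp add: power2_eq_square algebra_simps flip: abs_mult)
      also have "\<dots> \<le> 1 / real B * 2"
        using near[OF i] usphere_coordinate_bound[of x m i] usphere_coordinate_bound[of y m i] xy assms(2)
        by (intro mult_mono) (auto simp: subset_iff)
      finally show "\<bar>(y i)\<^sup>2 - (x i)\<^sup>2\<bar> \<le> 2 / real B" by simp
    qed
    also have "\<dots> = real m * 2 / real B" using j[OF xy(1)] by simp
    also have "\<dots> \<le> n * 2 / real B" by (simp add: n_def divide_right_mono)
    finally have "\<bar>?a - ?b\<bar> * \<bar>?a + ?b\<bar> \<le> n * 2 / real B" by (simp add: abs_mult)
    moreover have "\<bar>?a + ?b\<bar> \<ge> 2 / n"
    proof -
      have "1 / n \<le> \<bar>?a\<bar>" "1 / n \<le> \<bar>?b\<bar>" using j[OF xy(1)] j[OF xy(2)] jj by auto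
      moreover have "0 < n" using n by simp
      ultimately show ?thesis using sgn by (auto simp: abs_if split: if_splits)
    qed
    then have "\<bar>?a - ?b\<bar> * (2 / n) \<le> \<bar>?a - ?b\<bar> * \<bar>?a + ?b\<bar>" by (intro mult_left_mono) auto
    ultimately have "\<bar>?a - ?b\<bar> * (2 / n) \<le> n * 2 / real B" by linarith
    then have "\<bar>?a - ?b\<bar> * (2 / n) * (n / 2) \<le> n * 2 / real B * (n / 2)"
      using n by (intro mult_right_mono) auto
    then show ?thesis using n by (simp add: power2_eq_square)
  qed
  have "\<bar>x i - y i\<bar> \<le> n\<^sup>2 / real B" for i
  proof -
    have "1 / real B \<le> n\<^sup>2 / real B" using n by (intro divide_right_mono) (auto simp: one_le_power)
    moreover have "x i - y i = 0" if "i > m"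
    proof -
      have "x \<in> usphere m" "y \<in> usphere m" using xy(1,2) assms(2) by blast+
      then show ?thesis using that by (simp add: usphere_def)
    qed
    ultimately show ?thesis
      using near[of i] jnear by (cases "i > m"; cases "i = j x") auto
  qed
  from dist_fun_le_coordinate_bound[of x y, OF this] xy show ?thesis
    by (auto simp: n_def)
qed

text \<open>The image of the \<open>m\<close>-sphere under \<open>(F\<^sub>0, \<dots>, F\<^bsub>m+1\<^esub>)\<close> misses the line spanned by
some \<open>(w\<^sub>0, \<dots>, w\<^sub>m, 1)\<close>. Otherwise choose for each of the \<open>M\<^bsup>m+1\<^esup>\<close> grid points \<open>w\<close> of the unit cube a point of the
sphere that is sent to its line. Since \<open>w\<close> is recovered from that point as a quotient of Lipschitz functions
with denominator at least \<open>c\<close>, these points have mutual distances of order at least \<open>1 / M\<close>, and \<open>usphere_packing\<close>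
allows only \<open>O(M\<^sup>m)\<close> of them.\<close>

lemma lipschitz_image_misses_line:
  fixes F :: "nat \<Rightarrow> (nat \<Rightarrow> real) \<Rightarrow> real"
  assumes lip: "\<And>i. i \<le> Suc m \<Longrightarrow> L-lipschitz_on (usphere m) (F i)"
    and "0 < c" and c: "\<And>x. x \<in> usphere m \<Longrightarrow> \<exists>i\<le>Suc m. c \<le> \<bar>F i x\<bar>"
  shows "\<exists>w. \<forall>x\<in>usphere m. \<exists>i\<le>m. F i x \<noteq> w i * F (Suc m) x"
proof (rule ccontr)
  assume "\<not> ?thesis"
  then have "\<forall>w. \<exists>x\<in>usphere m. \<forall>i\<le>m. F i x = w i * F (Suc m) x" by blast
  then obtain X where X: "\<And>w. X w \<in> usphere m" and eq: "\<And>w i. i \<le> m \<Longrightarrow> F i (X w) = w i * F (Suc m) (X w)"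
    by metis
  have "L \<ge> 0" using lipschitz_on_nonneg lip by blast
  define n where "n = real (Suc m)"
  \<comment> \<open>\<open>C\<close> absorbs the Lipschitz data, so that boxes of side \<open>1 / (C * M)\<close> separate the chosen
      points; \<open>M\<close> then makes \<open>M\<^bsup>m+1\<^esup>\<close> exceed the packing bound.\<close>
  obtain C :: nat where C: "real C > 4 * L * n\<^sup>2 / c" using reals_Archimedean2 by blast
  then have C1: "C \<ge> 1"
    using \<open>L \<ge> 0\<close> \<open>0 < c\<close> by (smt (verit) divide_nonneg_pos mult_nonneg_nonneg of_nat_0 less_one not_le zero_le_power2)
  define M where "M = Suc (Suc m * (2 * (3 * C) ^ m))"
  have M1: "M \<ge> 1" by (simp add: M_def)
  define W where "W = PiE {..m} (\<lambda>_. {0..<M})"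
  define pt where "pt a = X (\<lambda>i. real (a i) / real M)" for a :: "nat \<Rightarrow> nat"
  \<comment> \<open>As \<open>0 \<le> w \<le> 1\<close>, the last component dominates the others on the chosen points.\<close>
  have bigF: "c \<le> \<bar>F (Suc m) (pt a)\<bar>" if a: "a \<in> W" for a
  proof -
    obtain i where i: "i \<le> Suc m" "c \<le> \<bar>F i (pt a)\<bar>" using c X unfolding pt_def by blast
    show ?thesis
    proof (cases "i = Suc m")
      case False
      then have im: "i \<le> m" using i by simp
      have "a i < M" using a im by (auto simp: W_def PiE_iff)
      then have "\<bar>real (a i) / real M\<bar> \<le> 1" by simp
      then have "\<bar>F i (pt a)\<bar> \<le> \<bar>F (Suc m) (pt a)\<bar>"
        unfolding pt_def eq[OF im] abs_mult by (intro mult_left_le_one_le) auto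
      then show ?thesis using i by simp
    qed (use i in auto)
  qed
  have sep: "a = b" if a: "a \<in> W" and b: "b \<in> W" and d: "dist (pt a) (pt b) \<le> 2 * n\<^sup>2 / real (C * M)" for a b
  proof -
    have "a i = b i" if im: "i \<le> m" for i
    proof -
      let ?v = "real (a i) / real M" and ?w = "real (b i) / real M"
      have "(?v - ?w) * F (Suc m) (pt a) =
          (F i (pt a) - F i (pt b)) - ?w * (F (Suc m) (pt a) - F (Suc m) (pt b))"
        unfolding pt_def eq[OF im] by (simp add: algebra_simps)
      moreover have "\<bar>(F i (pt a) - F i (pt b)) - ?w * (F (Suc m) (pt a) - F (Suc m) (pt b))\<bar>
          \<le> L * dist (pt a) (pt b) + 1 * (L * dist (pt a) (pt b))"
      proof (rule order_trans[OF abs_triangle_ineq4 add_mono])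
        show "\<bar>F i (pt a) - F i (pt b)\<bar> \<le> L * dist (pt a) (pt b)"
          using lipschitz_onD[OF lip[of i]] X im by (simp add: pt_def dist_real_def)
        have "b i < M" using b im by (auto simp: W_def PiE_iff)
        moreover have "\<bar>F (Suc m) (pt a) - F (Suc m) (pt b)\<bar> \<le> L * dist (pt a) (pt b)"
          using lipschitz_onD[OF lip[of "Suc m"]] X by (simp add: pt_def dist_real_def)
        ultimately show "\<bar>?w * (F (Suc m) (pt a) - F (Suc m) (pt b))\<bar> \<le> 1 * (L * dist (pt a) (pt b))"
          unfolding abs_mult by (intro mult_mono) auto
      qed
      moreover have "2 * L * dist (pt a) (pt b) \<le> 2 * L * (2 * n\<^sup>2 / real (C * M))"
        using d \<open>L \<ge> 0\<close> by (intro mult_left_mono) auto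
      ultimately have "\<bar>(?v - ?w) * F (Suc m) (pt a)\<bar> \<le> 2 * L * (2 * n\<^sup>2 / real (C * M))"
        by simp
      also have "\<dots> = (4 * L * n\<^sup>2 / c) * c / (real C * real M)"
        using \<open>0 < c\<close> by simp
      also have "\<dots> < real C * c / (real C * real M)"
        using C \<open>0 < c\<close> C1 M1 by (intro divide_strict_right_mono mult_strict_right_mono) auto
      also have "\<dots> = c / real M" using C1 by simp
      finally have "\<bar>?v - ?w\<bar> * \<bar>F (Suc m) (pt a)\<bar> < c / real M" by (simp add: abs_mult)
      moreover have "\<bar>?v - ?w\<bar> * c \<le> \<bar>?v - ?w\<bar> * \<bar>F (Suc m) (pt a)\<bar>"
        using bigF[OF a] by (intro mult_left_mono) auto
      ultimately have "\<bar>?v - ?w\<bar> * c < c / real M" by linarith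
      then have "\<bar>?v - ?w\<bar> * c < 1 / real M * c" by simp
      then have "\<bar>?v - ?w\<bar> < 1 / real M" using \<open>0 < c\<close> by (simp only: mult_less_cancel_right_pos)
      moreover have "?v - ?w = (real (a i) - real (b i)) / real M"
        by (simp add: diff_divide_distrib)
      ultimately have "\<bar>real (a i) - real (b i)\<bar> / real M < 1 / real M"
        by (simp add: abs_divide)
      then have "\<bar>real (a i) - real (b i)\<bar> < 1" using M1 by (simp add: divide_less_cancel)
      then show ?thesis by linarith
    qed
    then show ?thesis using a b by (auto simp: W_def intro: PiE_ext)
  qed
  have "finite W" by (auto simp: W_def intro: finite_PiE)
  have inj: "inj_on pt W"
    using sep by (intro inj_onI) (simp add: M_def)
  have "card (pt ` W) = M ^ Suc m"
    unfolding card_image[OF inj] by (simp add: W_def card_PiE)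
  moreover have "Suc m * (2 * (2 * (C * M) + 1) ^ m) < M ^ Suc m"
  proof -
    have "2 * (C * M) + 1 \<le> 3 * C * M" using C1 M1 by (simp add: Suc_le_eq)
    then have "Suc m * (2 * (2 * (C * M) + 1) ^ m) \<le> Suc m * (2 * (3 * C * M) ^ m)"
      by (intro mult_le_mono2 power_mono) auto
    also have "\<dots> = Suc m * (2 * (3 * C) ^ m) * M ^ m" by (simp add: power_mult_distrib algebra_simps)
    also have "\<dots> < M * M ^ m" using M1 by (intro mult_strict_right_mono) (auto simp: M_def)
    finally show ?thesis by simp
  qed
  ultimately have "\<exists>x\<in>pt ` W. \<exists>y\<in>pt ` W. x \<noteq> y \<and> dist x y \<le> 2 * (real (Suc m))\<^sup>2 / real (C * M)"
    using \<open>finite W\<close> X C1 M1 by (intro usphere_packing) (auto simp: pt_def)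
  then show False using sep unfolding n_def by (metis imageE)
qed

section \<open>Odd maps between spheres\<close>

text \<open>Induction on the dimension, with a deformation that makes the map preserve the equator.
The final stage \<open>(F\<^sub>i - w\<^sub>i F\<^sub>n)\<^bsub>i<n\<^esub>, \<bar>x\<^sub>n\<bar> F\<^sub>n\<close> is odd, since \<open>F\<close> is odd and the factor \<open>\<bar>x\<^sub>n\<bar>\<close> is
even. It can vanish only on the equator, and there only if \<open>F\<close> takes a value on the missed line.\<close>

theorem Borsuk_odd_mapping_degree:
  assumes "continuous_on (usphere n) f" "f \<in> usphere n \<rightarrow> usphere n"
    and "\<And>x. x \<in> usphere n \<Longrightarrow> f (- x) = - f x"
  shows "odd (Brouwer_degree2 n f)"
  using assms
proof (induction n arbitrary: f)
  case 0
  define e :: "nat \<Rightarrow> real" where "e = (\<lambda>i. if i = 0 then 1 else 0)"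
  have two: "x = e \<or> x = - e" if "x \<in> usphere 0" for x
    using that by (auto simp: usphere_def e_def power2_eq_1_iff fun_eq_iff)
  have e: "e \<in> usphere 0" by (simp add: usphere_def e_def)
  consider "f e = e" | "f e = - e" using two 0(2) e by blast
  then show ?case
  proof cases
    case 1
    have "f x = id x" if "x \<in> usphere 0" for x
      using two[OF that] 1 0(3)[OF e] by (metis id_apply)
    then have "Brouwer_degree2 0 f = Brouwer_degree2 0 id"
      by (intro Brouwer_degree2_eq) (simp add: nsphere_eq_usphere)
    then show ?thesis by simp
  next
    case 2
    have "f x = (\<lambda>i. if i = 0 then - x i else x i)" if "x \<in> usphere 0" for x
    proof -
      have "f x = - x" using two[OF that] 2 0(3)[OF e] by metis
      then show ?thesis using that by (auto simp: usphere_def fun_eq_iff)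
    qed
    then have "Brouwer_degree2 0 f = Brouwer_degree2 0 (\<lambda>x i. if i = 0 then - x i else x i)"
      by (intro Brouwer_degree2_eq) (simp add: nsphere_eq_usphere)
    then show ?thesis by (simp add: Brouwer_degree2_reflection)
  qed
next
  case (Suc m)
  let ?n = "Suc m"
  define c where "c = 1 / (2 * real (Suc ?n))"
  have "c > 0" by (simp add: c_def)
  have "\<exists>g L. L-lipschitz_on (usphere ?n) g \<and> (\<forall>x\<in>usphere ?n. g (- x) = - g x) \<and>
           (\<forall>x\<in>usphere ?n. \<bar>g x - f x i\<bar> \<le> c)" for i
  proof (rule odd_lipschitz_approximation)
    show "f (- x) i = - f x i" if "x \<in> usphere ?n" for x
      by (subst Suc.prems(3)[OF that]) simp
  qed (use continuous_on_coordinate[OF Suc.prems(1)] \<open>c > 0\<close> in auto)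
  then obtain F L where L: "\<And>i. (L i)-lipschitz_on (usphere ?n) (F i)"
    and F_odd: "\<And>i x. x \<in> usphere ?n \<Longrightarrow> F i (- x) = - F i x"
    and F_near: "\<And>i x. x \<in> usphere ?n \<Longrightarrow> \<bar>F i x - f x i\<bar> \<le> c"
    by metis
  have F_cont: "continuous_on (usphere ?n) (F i)" for i
    using L lipschitz_on_continuous_on by blast
  have large: "\<exists>i\<le>?n. 2 * c \<le> \<bar>f x i\<bar>" if "x \<in> usphere ?n" for x
  proof -
    have "2 * c = 1 / real (Suc ?n)" by (simp add: c_def field_simps)
    moreover have "f x \<in> usphere ?n" using Suc.prems(2) that by blast
    ultimately show ?thesis using usphere_large_coordinate by metis
  qed

  \<comment> \<open>After the shear by \<open>w\<close>, the first \<open>m + 1\<close> components have no common zero on the equator, where the last one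
      is going to be \<open>0\<close>.\<close>
  have "\<exists>w. \<forall>x\<in>usphere m. \<exists>i\<le>m. F i x \<noteq> w i * F ?n x"
  proof (rule lipschitz_image_misses_line)
    show "(\<Sum>i\<le>?n. L i)-lipschitz_on (usphere m) (F i)" if "i \<le> ?n" for i
      using that lipschitz_on_nonneg[OF L]
      by (intro lipschitz_on_mono[OF L usphere_mono] member_le_sum) auto
    show "\<exists>i\<le>?n. c \<le> \<bar>F i x\<bar>" if "x \<in> usphere m" for x
    proof -
      have x: "x \<in> usphere ?n" using that usphere_mono[of m ?n] by auto
      then obtain i where "i \<le> ?n" "2 * c \<le> \<bar>f x i\<bar>" using large by blast
      moreover have "\<bar>F i x - f x i\<bar> \<le> c" using F_near x .
      ultimately show ?thesis by (intro exI[of _ i]) linarith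
    qed
  qed (fact \<open>c > 0\<close>)
  then obtain w where w: "\<And>x. x \<in> usphere m \<Longrightarrow> \<exists>i\<le>m. F i x \<noteq> w i * F ?n x" by blast

  \<comment> \<open>\<open>H1\<close> moves \<open>f\<close> to \<open>F\<close> along segments; \<open>H2\<close> shears the missed line onto the last axis and
      shrinks the last component to \<open>0\<close> on the equator.\<close>
  define H1 where "H1 = (\<lambda>(s, x) i. (1 - s) * f x i + s * F i x)"
  define H2 where "H2 = (\<lambda>(s, x) i. if i = ?n then ((1 - s) + s * \<bar>x ?n\<bar>) * F ?n x
                                        else F i x - s * w i * F ?n x)"
  let ?D = "{0..1::real} \<times> usphere ?n"
  have cont_f: "continuous_on ?D (\<lambda>p. f (snd p) i)" for i
    by (rule continuous_on_compose2[OF continuous_on_coordinate[OF Suc.prems(1)] continuous_on_snd[OF continuous_on_id]]) auto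
  have cont_F: "continuous_on ?D (\<lambda>p. F i (snd p))" for i
    by (rule continuous_on_compose2[OF F_cont continuous_on_snd[OF continuous_on_id]]) auto
  have cont_x: "continuous_on ?D (\<lambda>p. snd p i)" for i
    by (intro continuous_on_coordinate continuous_on_snd continuous_on_id)

  have "Brouwer_degree2 ?n (\<lambda>x. normalise ?n (H1 (0, x))) = Brouwer_degree2 ?n (\<lambda>x. normalise ?n (H1 (1, x)))"
  proof (rule degree_homotopy_nonvanishing)
    show "continuous_on ?D (\<lambda>p. H1 p i)" for i
      unfolding H1_def case_prod_beta by (intro continuous_intros cont_f cont_F)
    fix s :: real and x assume s: "s \<in> {0..1}" and x: "x \<in> usphere ?n"
    obtain i where i: "i \<le> ?n" "2 * c \<le> \<bar>f x i\<bar>" using large x by blast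
    have "\<bar>s * (F i x - f x i)\<bar> \<le> 1 * c"
      unfolding abs_mult using s F_near[OF x] by (intro mult_mono) auto
    moreover have "H1 (s, x) i = f x i + s * (F i x - f x i)"
      by (simp add: H1_def algebra_simps)
    ultimately have "H1 (s, x) i \<noteq> 0" using i \<open>c > 0\<close> by linarith
    then show "\<exists>i\<le>?n. H1 (s, x) i \<noteq> 0" using i by blast
  qed
  moreover have "Brouwer_degree2 ?n (\<lambda>x. normalise ?n (H1 (0, x))) = Brouwer_degree2 ?n f"
    using Suc.prems(2) normalise_usphere
    by (intro Brouwer_degree2_eq) (auto simp: nsphere_eq_usphere H1_def Pi_iff)
  moreover have "H1 (1, x) = (\<lambda>i. F i x)" for x by (simp add: H1_def)
  ultimately have deg1: "Brouwer_degree2 ?n f = Brouwer_degree2 ?n (\<lambda>x. normalise ?n (\<lambda>i. F i x))" by simp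

  have H2_nonzero: "\<exists>i\<le>?n. H2 (s, x) i \<noteq> 0" if s: "s \<in> {0..1}" and x: "x \<in> usphere ?n" for s x
  proof (cases "F ?n x = 0")
    case True
    obtain i where i: "i \<le> ?n" "2 * c \<le> \<bar>f x i\<bar>" using large x by blast
    then have "F i x \<noteq> 0" using F_near[OF x, of i] \<open>c > 0\<close> by linarith
    then show ?thesis using i True by (intro exI[of _ i]) (auto simp: H2_def)
  next
    case False
    show ?thesis
    proof (cases "s = 1 \<and> x ?n = 0")
      case True
      then have "x \<in> usphere m" using usphere_equator x by blast
      then obtain i where "i \<le> m" "F i x \<noteq> w i * F ?n x" using w by blast
      then show ?thesis using True by (intro exI[of _ i]) (auto simp: H2_def)
    next
      case False
      then have "(1 - s) + s * \<bar>x ?n\<bar> > 0"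
        using s by (cases "s = 1") (auto intro: add_pos_nonneg)
      then show ?thesis using \<open>F ?n x \<noteq> 0\<close> by (intro exI[of _ ?n]) (auto simp: H2_def)
    qed
  qed
  have H2_cont: "continuous_on ?D (\<lambda>p. H2 p i)" for i
    unfolding H2_def case_prod_beta
    by (cases "i = ?n") (auto intro!: continuous_intros cont_F cont_x)
  define g where "g x = normalise ?n (H2 (1, x))" for x
  have "Brouwer_degree2 ?n (\<lambda>x. normalise ?n (H2 (0, x))) = Brouwer_degree2 ?n g"
    unfolding g_def by (rule degree_homotopy_nonvanishing[OF H2_cont H2_nonzero])
  moreover have "H2 (0, x) = (\<lambda>i. F i x)" for x by (auto simp: H2_def)
  ultimately have deg2: "Brouwer_degree2 ?n f = Brouwer_degree2 ?n g" using deg1 by simp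

  have g_cont: "continuous_on (usphere ?n) g"
    unfolding g_def
  proof (rule continuous_on_normalise)
    show "continuous_on (usphere ?n) (\<lambda>x. H2 (1, x) i)" for i
      by (rule continuous_on_compose2[OF H2_cont]) (auto intro!: continuous_intros)
  qed (use H2_nonzero in auto)
  have g_into: "g \<in> usphere ?n \<rightarrow> usphere ?n"
    using H2_nonzero[of 1] normalise_in_usphere unfolding g_def by fastforce
  have g_odd: "g (- x) = - g x" if "x \<in> usphere ?n" for x
  proof -
    have "H2 (1, - x) = - H2 (1, x)"
      using F_odd[OF that] by (auto simp: H2_def fun_eq_iff)
    then show ?thesis by (simp add: g_def normalise_uminus)
  qed
  have g_equator: "g x \<in> usphere m" if "x \<in> usphere m" for x
  proof -
    have x: "x \<in> usphere ?n" "x ?n = 0" using that usphere_equator by blast+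
    then have "g x ?n = 0" by (simp add: g_def normalise_def H2_def)
    moreover have "g x \<in> usphere ?n" using g_into x by blast
    ultimately show ?thesis using usphere_equator by blast
  qed
  have "even (Brouwer_degree2 ?n g - Brouwer_degree2 (?n - Suc 0) g)"
  proof (rule Borsuk_odd_mapping_degree_step)
    show "continuous_map (nsphere ?n) (nsphere ?n) g"
      using g_cont g_into by (auto simp: nsphere_eq_usphere)
    show "(g \<circ> (\<lambda>x i. - x i)) u = ((\<lambda>x i. - x i) \<circ> g) u" if "u \<in> topspace (nsphere ?n)" for u
      using g_odd[of u] that by (simp add: nsphere_eq_usphere fun_Compl_def)
    show "g \<in> topspace (nsphere (?n - Suc 0)) \<rightarrow> topspace (nsphere (?n - Suc 0))"
      using g_equator by (simp add: nsphere_eq_usphere)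
  qed
  moreover have "odd (Brouwer_degree2 m g)"
  proof (rule Suc.IH)
    have sub: "usphere m \<subseteq> usphere ?n" by (simp add: usphere_mono)
    show "continuous_on (usphere m) g" using g_cont sub by (rule continuous_on_subset)
    show "g (- x) = - g x" if "x \<in> usphere m" for x using g_odd sub that by blast
  qed (use g_equator in blast)
  ultimately show ?case unfolding deg2 by simp
qed

text \<open>Regarded as a self-map of the larger sphere, \<open>h\<close> would have odd degree by oddness and degree \<open>0\<close>
since it is not surjective.\<close>

theorem Borsuk_Ulam_no_odd_map:
  assumes "q < p" "continuous_on (usphere p) h" "h \<in> usphere p \<rightarrow> usphere q"
    and "\<And>x. x \<in> usphere p \<Longrightarrow> h (- x) = - h x"
  shows False
proof -
  have into: "h \<in> usphere p \<rightarrow> usphere p" using assms(1,3) usphere_mono[of q p] by auto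
  define e :: "nat \<Rightarrow> real" where "e = (\<lambda>i. if i = p then 1 else 0)"
  have "e \<in> usphere p" by (simp add: e_def usphere_def if_distrib[of "\<lambda>t. t\<^sup>2"] cong: if_cong)
  moreover have "e \<notin> usphere q" using assms(1) by (auto simp: e_def usphere_def)
  ultimately have "h ` usphere p \<noteq> usphere p" using assms(3) by (metis funcset_image subsetD)
  then have "Brouwer_degree2 p h = 0"
    using assms(2) into by (intro Brouwer_degree2_nonsurjective) (auto simp: nsphere_eq_usphere)
  moreover have "odd (Brouwer_degree2 p h)"
    using Borsuk_odd_mapping_degree[OF assms(2) into assms(4)] .
  ultimately show False by simp
qed

text \<open>An odd map from the image into a sphere of smaller dimension could be composed with \<open>\<phi>\<close>, against
\<open>Borsuk_Ulam_no_odd_map\<close>.\<close>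

lemma krasnoselski_genus_odd_sphere_image:
  assumes cont: "continuous_on (usphere p) \<phi>"
    and odd: "\<And>x. x \<in> usphere p \<Longrightarrow> \<phi> (- x) = - \<phi> x"
  shows "enat (Suc p) \<le> krasnoselski_genus (\<phi> ` usphere p)"
proof -
  let ?T = "\<phi> ` usphere p"
  have "Suc p \<le> k" if k: "k \<ge> 1" and h: "continuous_map (top_of_set ?T) (nsphere (k - 1)) h"
    and h_odd: "\<forall>u\<in>?T. h (- u) = - h u" for k h
  proof (rule ccontr)
    assume "\<not> Suc p \<le> k"
    then have "k - 1 < p" using k by linarith
    moreover have "continuous_on ?T h" "h \<in> ?T \<rightarrow> usphere (k - 1)"
      using h by (auto simp: nsphere_eq_usphere)
    then have "continuous_on (usphere p) (\<lambda>x. h (\<phi> x))" "(\<lambda>x. h (\<phi> x)) \<in> usphere p \<rightarrow> usphere (k - 1)"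
      using continuous_on_compose2[OF _ cont, of ?T h] by auto
    moreover have "h (\<phi> (- x)) = - h (\<phi> x)" if "x \<in> usphere p" for x
      using odd[OF that] h_odd that by auto
    ultimately show False by (rule Borsuk_Ulam_no_odd_map)
  qed
  moreover have "?T \<noteq> {}"
    using in_topspace_nsphere[of p] by (auto simp: nsphere_eq_usphere)
  ultimately show ?thesis
    unfolding krasnoselski_genus_def by (auto intro!: Inf_greatest)
qed



section \<open>Maximal connected subsets\<close>

definition reach :: "('b \<Rightarrow> 'b \<Rightarrow> bool) \<Rightarrow> 'b set \<Rightarrow> 'b rel" where
  "reach nb S = {(x, y). x \<in> S \<and> y \<in> S \<and> nb x y}\<^sup>*"

definition connected_in :: "('b \<Rightarrow> 'b \<Rightarrow> bool) \<Rightarrow> 'b set \<Rightarrow> bool" where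
  "connected_in nb A \<longleftrightarrow> (\<forall>x\<in>A. \<forall>y\<in>A. (x, y) \<in> reach nb A)"

lemma reach_mono: "A \<subseteq> B \<Longrightarrow> reach nb A \<subseteq> reach nb B"
  unfolding reach_def by (intro rtrancl_mono) auto

lemma reach_in: "(x, y) \<in> reach nb S \<Longrightarrow> x \<in> S \<Longrightarrow> y \<in> S"
  unfolding reach_def by (induction rule: rtrancl_induct) auto

lemma sym_reach: "symp nb \<Longrightarrow> sym (reach nb S)"
  unfolding reach_def by (intro sym_rtrancl) (auto simp: sym_def symp_def)

lemma trans_reach: "trans (reach nb S)"
  unfolding reach_def by (rule trans_rtrancl)

lemma reach_class_subset: "x \<in> S \<Longrightarrow> reach nb S `` {x} \<subseteq> S"
  using reach_in by fastforce

lemma self_in_reach_class: "x \<in> reach nb S `` {x}"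
  by (simp add: reach_def)

text \<open>A chain that starts at \<open>x\<close> never leaves the class of \<open>x\<close>, so it is a chain inside that class.\<close>

lemma connected_reach_class:
  assumes "symp nb" "x \<in> S"
  shows "connected_in nb (reach nb S `` {x})"
proof -
  define A where "A = reach nb S `` {x}"
  have from_x: "(x, y) \<in> reach nb A" if "(x, y) \<in> reach nb S" for y
    using that unfolding reach_def[of nb S]
  proof (induction rule: rtrancl_induct)
    case base
    show ?case by (simp add: reach_def)
  next
    case (step y z)
    then have "(x, y) \<in> reach nb S" "(x, z) \<in> reach nb S"
      unfolding reach_def by (auto intro: rtrancl_into_rtrancl)
    with step.hyps have "(y, z) \<in> {(u, v). u \<in> A \<and> v \<in> A \<and> nb u v}" by (auto simp: A_def)
    with step.IH show ?case
      unfolding reach_def[of nb A] by (rule rtrancl_into_rtrancl)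
  qed
  then show ?thesis
    unfolding connected_in_def A_def[symmetric] using sym_reach[OF assms(1), of A] trans_reach[of nb A]
    unfolding A_def by (metis Image_singleton_iff symD transD)
qed

text \<open>The set \<open>S\<close> has to be nonempty: the empty set is connected, and it is maximal within \<open>S = {}\<close>, where
there are no classes.\<close>

lemma maximal_connected_eq_reach_classes:
  assumes "symp nb" "S \<noteq> {}"
  shows "{A. A \<subseteq> S \<and> connected_in nb A \<and> (\<forall>A'. A \<subseteq> A' \<and> A' \<subseteq> S \<and> connected_in nb A' \<longrightarrow> A' = A)}
         = (\<lambda>x. reach nb S `` {x}) ` S" (is "?L = ?R")
proof (intro equalityI subsetI)
  fix A assume A: "A \<in> ?L"
  have "A \<noteq> {}"
  proof
    assume "A = {}"
    moreover obtain x where "x \<in> S" using assms(2) by blast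
    moreover have "connected_in nb {x}" by (simp add: connected_in_def reach_def)
    ultimately show False using A by (auto dest: spec[of _ "{x}"])
  qed
  then obtain x where x: "x \<in> A" by blast
  with A have "x \<in> S" by blast
  have "A \<subseteq> reach nb S `` {x}"
    using A x reach_mono[of A S nb] unfolding connected_in_def by blast
  then have "reach nb S `` {x} = A"
    using A connected_reach_class[OF assms(1) \<open>x \<in> S\<close>] reach_class_subset[OF \<open>x \<in> S\<close>] by blast
  then show "A \<in> ?R" using \<open>x \<in> S\<close> by blast
next
  fix A assume "A \<in> ?R"
  then obtain x where x: "x \<in> S" and A: "A = reach nb S `` {x}" by blast
  have "A' = A" if "A \<subseteq> A'" "A' \<subseteq> S" "connected_in nb A'" for A'
  proof
    have "x \<in> A'" using that self_in_reach_class[of x nb S] A by blast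
    then show "A' \<subseteq> A"
      using that reach_mono[of A' S nb] unfolding connected_in_def A by blast
  qed (rule that(1))
  then show "A \<in> ?L"
    using connected_reach_class[OF assms(1) x] reach_class_subset[OF x, of nb] A by auto
qed

section \<open>Nodal domains\<close>

lemma symp_neighbours: "symp (neighbours dir K d)"
  by (cases dir) (auto simp: symp_def)

definition nodal_class :: "direction \<Rightarrow> 'a set set \<Rightarrow> nat \<Rightarrow> ('a set \<Rightarrow> real) \<Rightarrow> 'a set \<Rightarrow> 'a set set" where
  "nodal_class dir K d f F = reach (neighbours dir K d) (face_support K d f) `` {F}"

lemma nodal_domains_eq_classes:
  assumes "face_support K d f \<noteq> {}"
  shows "nodal_domains dir K d f = nodal_class dir K d f ` face_support K d f"
  using maximal_connected_eq_reach_classes[OF symp_neighbours assms, of dir K d]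
  by (simp add: nodal_domains_def face_connected_def nodal_class_def connected_in_def reach_def)

lemma face_support_nonempty:
  assumes "f \<in> vectors (faces K (int d))" "f \<noteq> (\<lambda>_. 0)"
  shows "face_support K d f \<noteq> {}"
  using assms by (force simp: vectors_def face_support_def fun_eq_iff)

lemma nodal_class_eqI:
  assumes "F \<in> face_support K d f" "F' \<in> nodal_class dir K d f F"
  shows "nodal_class dir K d f F' = nodal_class dir K d f F"
proof -
  let ?r = "reach (neighbours dir K d) (face_support K d f)"
  have "(F, F') \<in> ?r" using assms by (auto simp: nodal_class_def)
  moreover from this have "(F', F) \<in> ?r" using sym_reach[OF symp_neighbours] by (metis symD)
  ultimately show ?thesis
    unfolding nodal_class_def by (auto intro: transD[OF trans_reach])
qed

lemma nodal_class_neighbours: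
  assumes "F \<in> face_support K d f" "F' \<in> face_support K d f" "neighbours dir K d F F'"
  shows "nodal_class dir K d f F = nodal_class dir K d f F'"
proof -
  have "F' \<in> nodal_class dir K d f F" using assms by (auto simp: nodal_class_def reach_def)
  from nodal_class_eqI[OF assms(1) this] show ?thesis by simp
qed

lemma finite_faces: "abstract_simplicial_complex V K \<Longrightarrow> finite (faces K j)"
  unfolding abstract_simplicial_complex_def faces_def
  by (metis (no_types, lifting) finite_Pow_iff finite_subset mem_Collect_eq subsetI)

section \<open>Energy along the nodal domains of an eigenvector\<close>

text \<open>The reason that nodal domains do not interact in \<open>B\<close>: a row face meets at most one of them.\<close>

lemma incident_faces_neighbours:
  assumes "G \<in> row_faces dir K d" "incidence dir G F \<noteq> 0" "incidence dir G F' \<noteq> 0" "F \<noteq> F'"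
  shows "neighbours dir K d F F'"
  using assms by (cases dir) auto

lemma incidence_bounds: "0 \<le> incidence dir G F" "incidence dir G F \<le> 1"
  by (cases dir; simp)+

lemma mult_B_adjoint:
  assumes "finite (faces K (int d))"
  shows "(\<Sum>G\<in>row_faces dir K d. g G * mult_B dir K d u G)
       = (\<Sum>F\<in>faces K (int d). mult_B_transpose dir K d g F * u F)"
proof -
  have "(\<Sum>G\<in>row_faces dir K d. g G * mult_B dir K d u G)
      = (\<Sum>G\<in>row_faces dir K d. \<Sum>F\<in>faces K (int d). g G * (incidence dir G F * u F))"
    by (intro sum.cong) (auto simp: mult_B_def sum_distrib_left)
  also have "\<dots> = (\<Sum>F\<in>faces K (int d). \<Sum>G\<in>row_faces dir K d. g G * (incidence dir G F * u F))"
    by (rule sum.swap)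
  also have "\<dots> = (\<Sum>F\<in>faces K (int d). mult_B_transpose dir K d g F * u F)"
    by (intro sum.cong) (auto simp: mult_B_transpose_def sum_distrib_left sum_distrib_right mult_ac)
  finally show ?thesis .
qed

lemma Sgn_real_mult: "s \<in> Sgn_real t \<Longrightarrow> s * t = \<bar>t\<bar>"
  by (auto simp: Sgn_real_def split: if_splits)

text \<open>The factor \<open>a\<close> is the common value of \<open>h\<close> on the support faces incident to \<open>G\<close>, or \<open>0\<close> if there are none. The second equation
with \<open>\<bar>h\<bar>\<close> has the same \<open>a\<close>, which is what lets one sign vector of \<open>B f\<close> compute \<open>\<bar>B (h f)\<bar>\<close>.\<close>

lemma mult_B_locally_constant_multiple:
  assumes "\<And>F F'. F \<in> face_support K d f \<Longrightarrow> F' \<in> face_support K d f \<Longrightarrow> neighbours dir K d F F' \<Longrightarrow> h F = h F'"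
    and "G \<in> row_faces dir K d"
  shows "\<exists>a. mult_B dir K d (\<lambda>F. h F * f F) G = a * mult_B dir K d f G \<and>
             mult_B dir K d (\<lambda>F. \<bar>h F\<bar> * f F) G = \<bar>a\<bar> * mult_B dir K d f G"
proof (cases "\<exists>F0\<in>face_support K d f. incidence dir G F0 \<noteq> 0")
  case True
  then obtain F0 where F0: "F0 \<in> face_support K d f" "incidence dir G F0 \<noteq> 0" by blast
  have const: "h F = h F0" if "F \<in> face_support K d f" "incidence dir G F \<noteq> 0" for F
    using assms(1)[OF that(1) F0(1)] incident_faces_neighbours[OF assms(2) that(2) F0(2)] by blast
  have "mult_B dir K d (\<lambda>F. k (h F) * f F) G = k (h F0) * mult_B dir K d f G" for k :: "real \<Rightarrow> real"
  proof -
    have "incidence dir G F * (k (h F) * f F) = k (h F0) * (incidence dir G F * f F)"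
      if "F \<in> faces K (int d)" for F
      using const[of F] that unfolding face_support_def
      by (cases "f F = 0"; cases "incidence dir G F = 0"; simp)
    then have "(\<Sum>F\<in>faces K (int d). incidence dir G F * (k (h F) * f F))
        = (\<Sum>F\<in>faces K (int d). k (h F0) * (incidence dir G F * f F))"
      by (rule sum.cong[OF refl])
    then show ?thesis
      using assms(2) by (simp add: mult_B_def sum_distrib_left)
  qed
  from this[of "\<lambda>t. t"] this[of abs] show ?thesis by blast
next
  case False
  then have z: "incidence dir G F = 0 \<or> f F = 0" if "F \<in> faces K (int d)" for F
    using that by (auto simp: face_support_def)
  have "mult_B dir K d (\<lambda>F. k F * f F) G = 0" for k
    using z by (fastforce simp: mult_B_def intro: sum.neutral)
  then show ?thesis by (intro exI[of _ 0]) simp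
qed

text \<open>At each row \<open>G\<close>, \<open>\<bar>B (h f)\<bar> = \<bar>a\<bar> \<bar>B f\<bar> = g \<cdot> \<bar>a\<bar> B f = g \<cdot> B (\<bar>h\<bar> f)\<close>, where \<open>g\<close> is
the sign vector in the eigenvalue equation. Moving \<open>B\<close> to the other side turns \<open>B\<^sup>T g\<close> into \<open>\<mu> D s\<close> with
\<open>s\<close> a sign vector of \<open>f\<close>.\<close>

lemma energy_locally_constant_multiple:
  assumes fin: "finite (faces K (int d))" and eig: "eigenpair dir K d \<mu> f"
    and h: "\<And>F F'. F \<in> face_support K d f \<Longrightarrow> F' \<in> face_support K d f \<Longrightarrow> neighbours dir K d F F' \<Longrightarrow> h F = h F'"
  shows "energy dir K d (\<lambda>F. h F * f F) = \<mu> * weighted_norm dir K d (\<lambda>F. h F * f F)"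
proof -
  obtain g s where g: "g \<in> Sgn (row_faces dir K d) (mult_B dir K d f)"
    and s: "s \<in> Sgn (faces K (int d)) f"
    and gs: "mult_B_transpose dir K d g = (\<lambda>F. \<mu> * (real (face_degree dir K d F) * s F))"
    using eig by (auto simp: eigenpair_def signless_1_laplacian_def)
  have "\<bar>mult_B dir K d (\<lambda>F. h F * f F) G\<bar> = g G * mult_B dir K d (\<lambda>F. \<bar>h F\<bar> * f F) G"
    if G: "G \<in> row_faces dir K d" for G
  proof -
    obtain a where a: "mult_B dir K d (\<lambda>F. h F * f F) G = a * mult_B dir K d f G"
      "mult_B dir K d (\<lambda>F. \<bar>h F\<bar> * f F) G = \<bar>a\<bar> * mult_B dir K d f G"
      using mult_B_locally_constant_multiple[of K d f dir h G] h G by blast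
    have "g G * mult_B dir K d f G = \<bar>mult_B dir K d f G\<bar>"
      using g G by (intro Sgn_real_mult) (auto simp: Sgn_def)
    then show ?thesis unfolding a by (simp add: abs_mult mult.left_commute)
  qed
  then have "energy dir K d (\<lambda>F. h F * f F)
      = (\<Sum>G\<in>row_faces dir K d. g G * mult_B dir K d (\<lambda>F. \<bar>h F\<bar> * f F) G)"
    by (simp add: energy_def)
  also have "\<dots> = (\<Sum>F\<in>faces K (int d). mult_B_transpose dir K d g F * (\<bar>h F\<bar> * f F))"
    by (rule mult_B_adjoint[OF fin])
  also have "\<dots> = (\<Sum>F\<in>faces K (int d). \<mu> * (real (face_degree dir K d F) * \<bar>h F * f F\<bar>))"
  proof (intro sum.cong refl)
    fix F assume "F \<in> faces K (int d)"
    then have "s F * f F = \<bar>f F\<bar>"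
      using s by (intro Sgn_real_mult) (auto simp: Sgn_def)
    then show "mult_B_transpose dir K d g F * (\<bar>h F\<bar> * f F) = \<mu> * (real (face_degree dir K d F) * \<bar>h F * f F\<bar>)"
      unfolding gs by (simp add: abs_mult mult.left_commute mult.assoc)
  qed
  finally show ?thesis by (simp add: weighted_norm_def sum_distrib_left)
qed

section \<open>Comparison with the variational eigenvalues\<close>

lemma energy_nonneg: "0 \<le> energy dir K d u"
  by (simp add: energy_def sum_nonneg)

text \<open>Degrees are at least \<open>1\<close>, so every entry of \<open>B u\<close> is bounded by the weighted norm. The bound makes
the suprema in the min-max values suprema of bounded sets.\<close>

lemma energy_le_on_unit_vectors:
  assumes fin: "finite (faces K (int d))" and deg: "\<forall>F\<in>faces K (int d). face_degree dir K d F > 0"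
    and u: "u \<in> unit_vectors dir K d"
  shows "energy dir K d u \<le> real (card (row_faces dir K d))"
proof -
  have "\<bar>mult_B dir K d u G\<bar> \<le> 1" if "G \<in> row_faces dir K d" for G
  proof -
    have "\<bar>mult_B dir K d u G\<bar> \<le> (\<Sum>F\<in>faces K (int d). \<bar>incidence dir G F * u F\<bar>)"
      using that by (simp add: mult_B_def)
    also have "\<dots> \<le> (\<Sum>F\<in>faces K (int d). real (face_degree dir K d F) * \<bar>u F\<bar>)"
    proof (intro sum_mono)
      fix F assume "F \<in> faces K (int d)"
      then have "1 \<le> real (face_degree dir K d F)" using deg by fastforce
      then show "\<bar>incidence dir G F * u F\<bar> \<le> real (face_degree dir K d F) * \<bar>u F\<bar>"
        unfolding abs_mult using incidence_bounds[of dir G F] by (intro mult_right_mono) auto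
    qed
    finally show ?thesis using u by (simp add: unit_vectors_def weighted_norm_def)
  qed
  then show ?thesis
    unfolding energy_def using sum_bounded_above[of "row_faces dir K d" "\<lambda>G. \<bar>mult_B dir K d u G\<bar>" 1] by simp
qed

text \<open>The energy is nonnegative and each admissible set is nonempty (its genus is positive) with bounded
energy. Hence the infimum is taken over a set bounded below, and any admissible set bounds it from above.\<close>

lemma variational_eigenvalue_le:
  assumes "finite (faces K (int d))" "\<forall>F\<in>faces K (int d). face_degree dir K d F > 0"
    and "1 \<le> j"
    and T: "T \<subseteq> unit_vectors dir K d" "uminus ` T = T" "enat j \<le> krasnoselski_genus T"
    and "\<And>u. u \<in> T \<Longrightarrow> energy dir K d u \<le> \<mu>"
  shows "variational_eigenvalue dir K d j \<le> \<mu>"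
proof -
  let ?\<T> = "{T. T \<subseteq> unit_vectors dir K d \<and> uminus ` T = T \<and> enat j \<le> krasnoselski_genus T}"
  have nonempty: "S \<noteq> {}" if "S \<in> ?\<T>" for S
    using that \<open>1 \<le> j\<close> by (auto simp: krasnoselski_genus_def zero_enat_def)
  have "0 \<le> (SUP u\<in>S. energy dir K d u)" if S: "S \<in> ?\<T>" for S
  proof -
    obtain u where "u \<in> S" using nonempty[OF S] by blast
    have "bdd_above (energy dir K d ` S)"
      using S by (intro bdd_aboveI2[OF energy_le_on_unit_vectors[OF assms(1,2)]]) auto
    with \<open>u \<in> S\<close> show ?thesis
      using energy_nonneg[of dir K d u] by (auto intro: cSUP_upper2)
  qed
  then have "bdd_below ((\<lambda>S. SUP u\<in>S. energy dir K d u) ` ?\<T>)"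
    by (intro bdd_belowI2[where m = 0])
  then have "variational_eigenvalue dir K d j \<le> (SUP u\<in>T. energy dir K d u)"
    unfolding variational_eigenvalue_def using T by (intro cINF_lower) auto
  also have "\<dots> \<le> \<mu>"
    using assms(7) T nonempty[of T] by (intro cSUP_least) auto
  finally show ?thesis .
qed


text \<open>The coordinates of a point of the sphere serve as the values of \<open>h\<close> on the \<open>p + 1\<close> nodal domains. The
vector \<open>h f\<close> is nonzero, because some coordinate is and \<open>f\<close> has no zero on its support, so it can be
normalised.\<close>

lemma energy_constant_on_odd_sphere:
  assumes fin: "finite (faces K (int d))" and deg: "\<forall>F\<in>faces K (int d). face_degree dir K d F > 0"
    and eig: "eigenpair dir K d \<mu> f"
    and m: "card (nodal_domains dir K d f) = Suc p"
  shows "\<exists>\<phi>. continuous_on (usphere p) \<phi> \<and> (\<forall>x\<in>usphere p. \<phi> (- x) = - \<phi> x) \<and>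
           (\<forall>x\<in>usphere p. \<phi> x \<in> unit_vectors dir K d \<and> energy dir K d (\<phi> x) = \<mu>)"
proof -
  let ?D = "nodal_domains dir K d f" and ?S = "face_support K d f" and ?cls = "nodal_class dir K d f"
  have f: "f \<in> vectors (faces K (int d))" "f \<noteq> (\<lambda>_. 0)" using eig by (auto simp: eigenpair_def)
  have D: "?D = ?cls ` ?S"
    by (rule nodal_domains_eq_classes[OF face_support_nonempty[OF f]])
  have "finite ?D" using m by (metis card.infinite nat.distinct(1))
  then obtain \<iota> where \<iota>: "bij_betw \<iota> ?D {0..<Suc p}"
    using ex_bij_betw_finite_nat[of ?D] m by auto
  \<comment> \<open>\<open>\<iota>\<close> numbers the nodal domains.\<close>
  define h where "h x F = x (\<iota> (?cls F))" for x :: "nat \<Rightarrow> real" and F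
  define N where "N x = weighted_norm dir K d (\<lambda>F. h x F * f F)" for x
  define \<phi> where "\<phi> x = (\<lambda>F. (h x F / N x) * f F)" for x
  have N_pos: "0 < N x" if x: "x \<in> usphere p" for x
  proof -
    obtain i where i: "i \<le> p" "1 / real (Suc p) \<le> \<bar>x i\<bar>" using usphere_large_coordinate[OF x] by blast
    then have "x i \<noteq> 0" by (auto simp: divide_le_0_iff)
    have "i \<in> \<iota> ` ?D" using bij_betw_imp_surj_on[OF \<iota>] i(1) by auto
    then obtain F where F: "F \<in> ?S" "i = \<iota> (?cls F)" unfolding D by blast
    have "F \<in> faces K (int d)" "f F \<noteq> 0" using F(1) by (auto simp: face_support_def)
    moreover have "h x F \<noteq> 0" using \<open>x i \<noteq> 0\<close> F(2) by (simp add: h_def)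
    ultimately show ?thesis
      unfolding N_def weighted_norm_def using deg by (intro sum_pos2[OF fin, of F]) auto
  qed
  have N_minus: "N (- x) = N x" for x by (simp add: N_def h_def weighted_norm_def)
  have norm1: "weighted_norm dir K d (\<phi> x) = 1" if "x \<in> usphere p" for x
  proof -
    have "weighted_norm dir K d (\<phi> x) = N x / N x"
      using N_pos[OF that]
      unfolding N_def[of x] \<phi>_def weighted_norm_def sum_divide_distrib
      by (intro sum.cong) (auto simp: abs_mult abs_divide N_def weighted_norm_def)
    then show ?thesis using N_pos[OF that] by simp
  qed
  have "continuous_on (usphere p) \<phi>"
  proof (rule continuous_on_coordinatewise_then_product)
    have h: "continuous_on (usphere p) (\<lambda>x. h x F)" for F
      unfolding h_def by (intro continuous_on_coordinate continuous_on_id)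
    then have "continuous_on (usphere p) N"
      unfolding N_def weighted_norm_def by (intro continuous_intros)
    then show "continuous_on (usphere p) (\<lambda>x. \<phi> x F)" for F
      unfolding \<phi>_def using N_pos h by (intro continuous_intros) force+
  qed
  moreover have "\<phi> (- x) = - \<phi> x" for x
    by (auto simp: \<phi>_def N_minus h_def)
  moreover have "\<phi> x \<in> unit_vectors dir K d \<and> energy dir K d (\<phi> x) = \<mu>" if "x \<in> usphere p" for x
  proof
    show "\<phi> x \<in> unit_vectors dir K d"
      using norm1[OF that] f(1) by (simp add: unit_vectors_def vectors_def \<phi>_def)
    have "energy dir K d (\<phi> x) = \<mu> * weighted_norm dir K d (\<phi> x)"
      unfolding \<phi>_def
      by (rule energy_locally_constant_multiple[OF fin eig]) (metis h_def nodal_class_neighbours)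
    then show "energy dir K d (\<phi> x) = \<mu>" by (simp add: norm1[OF that])
  qed
  ultimately show ?thesis by blast
qed

lemma variational_eigenvalue_le_eigenvalue:
  assumes "finite (faces K (int d))" "\<forall>F\<in>faces K (int d). face_degree dir K d F > 0"
    and "eigenpair dir K d \<mu> f" and "1 \<le> j" "j \<le> card (nodal_domains dir K d f)"
  shows "variational_eigenvalue dir K d j \<le> \<mu>"
proof -
  obtain p where p: "card (nodal_domains dir K d f) = Suc p"
    using assms(4,5) by (metis Suc_le_D le_trans One_nat_def)
  obtain \<phi> where cont: "continuous_on (usphere p) \<phi>"
    and odd: "\<And>x. x \<in> usphere p \<Longrightarrow> \<phi> (- x) = - \<phi> x"
    and \<phi>: "\<And>x. x \<in> usphere p \<Longrightarrow> \<phi> x \<in> unit_vectors dir K d"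
      "\<And>x. x \<in> usphere p \<Longrightarrow> energy dir K d (\<phi> x) = \<mu>"
    using energy_constant_on_odd_sphere[OF assms(1-3) p] by blast
  have "uminus ` usphere p = usphere p"
  proof
    show "usphere p \<subseteq> uminus ` usphere p"
    proof
      fix x assume "x \<in> usphere p"
      then show "x \<in> uminus ` usphere p"
        by (intro image_eqI[of _ _ "- x"]) (auto simp: usphere_uminus)
    qed
  qed (auto simp: usphere_uminus)
  moreover have "uminus ` \<phi> ` usphere p = \<phi> ` uminus ` usphere p"
    unfolding image_image using odd by (intro image_cong) auto
  ultimately have sym: "uminus ` \<phi> ` usphere p = \<phi> ` usphere p" by simp
  have "enat j \<le> krasnoselski_genus (\<phi> ` usphere p)"
    using krasnoselski_genus_odd_sphere_image[OF cont odd] assms(5) p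
    by (metis enat_ord_simps(1) order_trans)
  then show ?thesis
    using \<phi> sym by (intro variational_eigenvalue_le[OF assms(1,2,4)]) auto
qed

theorem theorem1:
  fixes V :: "'a set" and K :: "'a set set" and dir :: direction
    and d n k r :: nat and c :: "nat \<Rightarrow> real" and f :: "'a set \<Rightarrow> real"
  assumes "abstract_simplicial_complex V K"
    and "n = card (faces K (int d))" and "n \<ge> 1"
    and "\<forall>F\<in>faces K (int d). face_degree dir K d F > 0"
    and "c = variational_eigenvalue dir K d"
    and "1 \<le> k" and "1 \<le> r" and "k + r - 1 \<le> n"
    and "\<forall>j\<in>{k..k + r - 1}. c j = c k"
    and "k > 1 \<longrightarrow> c (k - 1) < c k"
    and "k + r - 1 < n \<longrightarrow> c (k + r - 1) < c (k + r)"
    and "eigenpair dir K d (c k) f"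
  shows "1 \<le> card (nodal_domains dir K d f) \<and> card (nodal_domains dir K d f) \<le> k + r - 1"
proof
  have fin: "finite (faces K (int d))" using finite_faces[OF assms(1)] .
  have supp: "face_support K d f \<subseteq> faces K (int d)" by (auto simp: face_support_def)
  have fin_supp: "finite (face_support K d f)" using supp fin by (rule finite_subset)
  have "face_support K d f \<noteq> {}"
    using assms(12) by (intro face_support_nonempty) (auto simp: eigenpair_def)
  then have D: "nodal_domains dir K d f = nodal_class dir K d f ` face_support K d f"
    and "nodal_domains dir K d f \<noteq> {}"
    using nodal_domains_eq_classes[of K d f dir] by auto
  then show "1 \<le> card (nodal_domains dir K d f)"
    using fin_supp by (simp add: Suc_le_eq card_gt_0_iff)
  show "card (nodal_domains dir K d f) \<le> k + r - 1"
  proof (rule ccontr)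
    assume "\<not> ?thesis"
    then have many: "k + r \<le> card (nodal_domains dir K d f)" by simp
    also have "\<dots> \<le> n"
      unfolding D assms(2) using card_image_le[OF fin_supp] card_mono[OF fin supp] by (rule le_trans)
    finally have "c (k + r - 1) < c (k + r)" using assms(6,11) by simp
    moreover have "c (k + r - 1) = c k"
      using assms(7) by (intro bspec[OF assms(9)]) auto
    moreover have "c (k + r) \<le> c k"
      using variational_eigenvalue_le_eigenvalue[OF fin assms(4,12) _ many] assms(5,6) by simp
    ultimately show False by simp
  qed
qed

end
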